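(* Let $q>3$ be a prime power. Then every element of $\mathrm{PSL}(2,q)$ is a coprime commutator; that is, for every $g\in \mathrm{PSL}(2,q)$ there exist $x,y\in \mathrm{PSL}(2,q)$ whose orders are coprime and such that $g=[x,y]$.
   Context: $\mathrm{PSL}(2,q)$ denotes the projective special linear group of degree 2 over the finite field with $q$ elements. The commutator convention is $[x,y]=x^{-1}y^{-1}xy$. An element of a group is called a coprime commutator if it can be written as $[x,y]$ with $x,y$ elements of the group of coprime orders. *)

theory Defs
  imports
    "HOL-Analysis.Determinants"
    "HOL-Algebra.Multiplicative_Group"
    "HOL-Number_Theory.Prime_Powers"
begin

definition SL2 :: "('a::field ^ 2 ^ 2) monoid" where
  "SL2 = \<lparr>carrier = {A. det A = 1}, mult = (**), one = mat 1\<rparr>"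

definition group_center :: "('g, 'm) monoid_scheme \<Rightarrow> 'g set" where
  "group_center G = {z \<in> carrier G. \<forall>x \<in> carrier G. z \<otimes>\<^bsub>G\<^esub> x = x \<otimes>\<^bsub>G\<^esub> z}"

definition PSL2 :: "('a::field ^ 2 ^ 2) set monoid" where
  "PSL2 = SL2 Mod group_center SL2"

(* The convention is [x, y] = x^-1 y^-1 x y, unlike in the library's derived_set. *)
definition commutator :: "('g, 'm) monoid_scheme \<Rightarrow> 'g \<Rightarrow> 'g \<Rightarrow> 'g" where
  "commutator G x y = inv\<^bsub>G\<^esub> x \<otimes>\<^bsub>G\<^esub> inv\<^bsub>G\<^esub> y \<otimes>\<^bsub>G\<^esub> x \<otimes>\<^bsub>G\<^esub> y"

(* group.ord is 0 on elements of infinite order; this does not arise in finite groups. *)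
definition coprime_commutator :: "('g, 'm) monoid_scheme \<Rightarrow> 'g \<Rightarrow> bool" where
  "coprime_commutator G g \<longleftrightarrow>
     (\<exists>x \<in> carrier G. \<exists>y \<in> carrier G.
        coprime (group.ord G x) (group.ord G y) \<and> g = commutator G x y)"

lemma group_SL2: "group (SL2 :: ('a::field ^ 2 ^ 2) monoid)"
proof (rule groupI)
  fix A :: "'a ^ 2 ^ 2"
  assume A: "A \<in> carrier SL2"
  define B :: "'a ^ 2 ^ 2" where
    "B = (\<chi> i j. if i = j then (if i = 1 then A $ 2 $ 2 else A $ 1 $ 1) else - (A $ i $ j))"
  from A have d: "A $ 1 $ 1 * A $ 2 $ 2 - A $ 1 $ 2 * A $ 2 $ 1 = 1"
    by (simp add: SL2_def det_2)
  have "det B = 1"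
    using d by (simp add: det_2 B_def algebra_simps)
  moreover have "B ** A = mat 1"
    using d by (simp add: vec_eq_iff forall_2 sum_2 matrix_matrix_mult_def mat_def B_def algebra_simps)
  ultimately show "\<exists>B \<in> carrier SL2. B \<otimes>\<^bsub>SL2\<^esub> A = \<one>\<^bsub>SL2\<^esub>"
    by (auto simp: SL2_def)
qed (auto simp: SL2_def det_mul matrix_mul_assoc)

lemma (in group) group_center_normal: "group_center G \<lhd> G"
proof (rule normalI)
  show "subgroup (group_center G) G"
  proof (rule subgroupI)
    show "group_center G \<noteq> {}"
      by (auto simp: group_center_def)
  next
    fix a assume "a \<in> group_center G"
    then have a: "a \<in> carrier G" "\<And>x. x \<in> carrier G \<Longrightarrow> a \<otimes> x = x \<otimes> a"
      by (auto simp: group_center_def)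
    have "inv a \<otimes> x = x \<otimes> inv a" if x: "x \<in> carrier G" for x
      using a(2)[of "inv x"] inv_mult_group[of a "inv x"] inv_mult_group[of "inv x" a] a(1) x by simp
    with a(1) show "inv a \<in> group_center G"
      by (simp add: group_center_def)
  next
    fix a b assume "a \<in> group_center G" "b \<in> group_center G"
    then have ab: "a \<in> carrier G" "b \<in> carrier G"
        "\<And>x. x \<in> carrier G \<Longrightarrow> a \<otimes> x = x \<otimes> a"
        "\<And>x. x \<in> carrier G \<Longrightarrow> b \<otimes> x = x \<otimes> b"
      by (auto simp: group_center_def)
    have "a \<otimes> b \<otimes> x = x \<otimes> (a \<otimes> b)" if x: "x \<in> carrier G" for x
    proof -
      have "a \<otimes> b \<otimes> x = a \<otimes> (x \<otimes> b)"
        using ab(1,2) x by (simp add: m_assoc ab(4))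
      also have "\<dots> = x \<otimes> a \<otimes> b"
        using ab(1,2) x by (simp add: m_assoc[symmetric] ab(3))
      finally show ?thesis
        using ab(1,2) x by (simp add: m_assoc)
    qed
    with ab(1,2) show "a \<otimes> b \<in> group_center G"
      by (simp add: group_center_def)
  qed (auto simp: group_center_def)
qed (auto simp: group_center_def r_coset_def l_coset_def)

lemma group_PSL2: "group (PSL2 :: ('a::field ^ 2 ^ 2) set monoid)"
  unfolding PSL2_def
  by (intro normal.factorgroup_is_group group.group_center_normal group_SL2)

end

theory Submission
  imports Defs "HOL-Number_Theory.Residues" "HOL-Computational_Algebra.Nth_Powers" "HOL-Computational_Algebra.Polynomial"
begin

text \<open>
  Lift the given element to a matrix \<open>A\<close> of determinant one. If \<open>A\<close> is scalar, its coset is the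
  identity. A non-scalar matrix is determined up to similarity by its trace and determinant
  (\<open>SL2_similar_if_trace_eq\<close>), and conjugation by an invertible matrix is an automorphism of the special linear group
  that fixes the scalars, hence preserves bounds on orders modulo scalars. So it suffices to find,
  for every trace \<open>t\<close>, two matrices \<open>X\<close> and \<open>Y\<close> that have coprime orders modulo scalars and a
  non-scalar commutator of trace \<open>t\<close> (\<open>coprime_commutator_PSL2_if_similar\<close>). Let \<open>q\<close> be the size of the field, and let
  \<open>a \<noteq> 0\<close> be such that \<open>u = a - 1/a \<noteq> 0\<close>; such \<open>a\<close> exist as \<open>q > 3\<close>.

  If \<open>t - 2 = c\<^sup>2\<close> is a square, take \<open>X\<close> to be the unipotent matrix with rows \<open>(1, 1)\<close> and
  \<open>(0, 1)\<close>, and \<open>Y\<close> with rows \<open>(a, 0)\<close> and \<open>(c, 1/a)\<close>. Their orders divide \<open>q\<close> and \<open>q - 1\<close>,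
  and the commutator has trace \<open>2 + c\<^sup>2\<close>.

  If \<open>k = t - 2\<close> is not a square, then \<open>q\<close> is odd. Elements of a split torus have order dividing
  \<open>(q - 1)/2\<close> modulo scalars and those of a non-split torus have order dividing \<open>(q + 1)/2\<close>; these
  numbers are consecutive, hence coprime. Take \<open>X\<close> diagonal with entries \<open>a\<close> and \<open>1/a\<close>. The
  trace of the commutator of \<open>X\<close> and \<open>Y\<close> depends only on the product \<open>e\<close> of the diagonal
  entries of \<open>Y\<close>, and it is \<open>t\<close> when \<open>e = 1 - k/u\<^sup>2\<close>. There remains the freedom to choose the diagonal of \<open>Y\<close> as
  \<open>w/u\<close> and \<open>e u/w\<close>. The discriminant of the characteristic polynomial of \<open>Y\<close> is then
  \<open>H(w - u) H(w + u)\<close> up to a square factor, where \<open>H(x) = x\<^sup>2 - k\<close>, and \<open>Y\<close> is non-split as soon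
  as exactly one of the two values of \<open>H\<close> is a square.

  The heart of the proof is that suitable \<open>a\<close> and \<open>w\<close> exist (\<open>exists_translates_differing_in_squareness\<close>). Otherwise the set of \<open>x\<close> for
  which \<open>H(x)\<close> is a square is invariant under translation by \<open>2 (a - 1/a)\<close> for every \<open>a \<noteq> 0\<close>.
  These elements number at least \<open>(q - 1)/2 > q/3\<close>, whereas a proper additive subgroup of a
  field of odd order has at most \<open>q/3\<close> elements. So the set is invariant under all translations,
  but \<open>H\<close> takes both square and non-square values.
\<close>

section \<open>Finite fields\<close>

lemma card_le_mult_card_image:
  assumes "finite A" "\<And>y. card {x \<in> A. f x = y} \<le> k"
  shows "card A \<le> k * card (f ` A)"
proof -
  have "card A = card (\<Union>y \<in> f ` A. {x \<in> A. f x = y})"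
    by (rule arg_cong[where f = card]) auto
  also have "\<dots> \<le> (\<Sum>y \<in> f ` A. card {x \<in> A. f x = y})"
    using assms(1) by (intro card_UN_le) auto
  also have "\<dots> \<le> (\<Sum>y \<in> f ` A. k)"
    by (intro sum_mono assms(2))
  finally show ?thesis by (simp add: mult.commute)
qed

lemma power_card_minus_1_eq_1:
  fixes x :: "'a::{finite, field}"
  assumes "x \<noteq> 0"
  shows "x ^ (CARD('a) - 1) = 1"
proof -
  have "(\<Prod>y\<in>UNIV - {0}. x * y) = (\<Prod>y\<in>UNIV - {0}. y)"
    by (rule prod.reindex_bij_witness[of _ "\<lambda>y. y / x" "\<lambda>y. x * y"]) (use assms in auto)
  moreover have "(\<Prod>y\<in>UNIV - {0}. x * y) = x ^ (CARD('a) - 1) * (\<Prod>y\<in>UNIV - {0}. y)"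
    by (simp add: prod.distrib)
  moreover have "(\<Prod>y\<in>UNIV - {0 :: 'a}. y) \<noteq> 0"
    by simp
  ultimately show ?thesis by simp
qed

text \<open>
  The characteristic is a prime divisor of the cardinality, so it is the base of the prime power.
  Powers of this form are what the Frobenius identity \<open>freshmans_dream'\<close> asks for.
\<close>
lemma card_power_CHAR:
  assumes "primepow CARD('a::{finite, field})"
  obtains n where "CARD('a) = CHAR('a) ^ n"
proof -
  obtain p n where pn: "prime p" "CARD('a) = p ^ n"
    using assms by (auto simp: primepow_def)
  have "prime CHAR('a)"
    using prime_CHAR_semidom[where 'a = 'a] finite_imp_CHAR_pos[where 'a = 'a] by simp
  moreover have "CHAR('a) dvd p ^ n"
    using CHAR_dvd_CARD[where 'a = 'a] pn by simp
  ultimately have "CHAR('a) = p"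
    using pn(1) prime_dvd_power primes_dvd_imp_eq by blast
  with pn that show thesis by blast
qed

lemma power_card_eq_same: "(x :: 'a::{finite, field}) ^ CARD('a) = x"
proof (cases "x = 0")
  case False
  have "x ^ CARD('a) = x ^ (CARD('a) - 1) * x"
    by (metis One_nat_def Suc_pred power_Suc2 zero_less_card_finite)
  with power_card_minus_1_eq_1[OF False] show ?thesis by simp
qed (simp add: power_0_left)

lemma four_neq_0:
  assumes "(2::'a::field) \<noteq> 0"
  shows "(4::'a) \<noteq> 0"
proof -
  have "(2::'a) * 2 \<noteq> 0" using assms by (simp only: mult_eq_0_iff) simp
  then show ?thesis by simp
qed

lemma odd_card:
  assumes "primepow CARD('a::{finite, field})" "(2::'a) \<noteq> 0"
  shows "odd CARD('a)"
proof
  assume "even CARD('a)"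
  moreover obtain n where "CARD('a) = CHAR('a) ^ n" using assms(1) by (rule card_power_CHAR)
  ultimately have "even CHAR('a)" by simp
  moreover have "prime CHAR('a)"
    using prime_CHAR_semidom[where 'a = 'a] finite_imp_CHAR_pos[where 'a = 'a] by simp
  ultimately have "CHAR('a) = 2" by (metis primes_dvd_imp_eq two_is_prime_nat)
  then have "of_nat 2 = (0 :: 'a)" by (metis of_nat_CHAR)
  with assms(2) show False by simp
qed

text \<open>
  In characteristic two squaring is injective, hence surjective on a finite field.
\<close>
lemma is_square_if_two_eq_0:
  fixes x :: "'a::{finite, field}"
  assumes "(2::'a) = 0"
  shows "is_square x"
proof -
  have "y = z" if "y ^ 2 = z ^ 2" for y z :: 'a
  proof -
    have "(y - z) ^ 2 = y^2 + z^2 - 2 * (y * z)"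
      by (simp add: power2_eq_square algebra_simps)
    also have "\<dots> = 2 * (z^2 - y * z)"
      using that by (simp add: algebra_simps)
    finally show ?thesis using assms by simp
  qed
  then have "inj (\<lambda>y :: 'a. y ^ 2)" by (auto intro: injI)
  then have "surj (\<lambda>y :: 'a. y ^ 2)" by (simp add: finite_UNIV_inj_surj)
  then show ?thesis by (metis is_nth_powerI surjD)
qed


text \<open>
  With \<open>h = (q - 1)/2\<close>, the power \<open>m\<^sup>h\<close> squares to \<open>1\<close>. It is not \<open>1\<close>, because the polynomial
  \<open>x\<^sup>h - 1\<close> has at most \<open>h\<close> roots, and the non-zero squares already supply \<open>h\<close> of them.
\<close>
lemma euler_criterion_nonsquare:
  fixes m :: "'a::{finite, field}"
  assumes odd: "odd CARD('a)" and m: "\<not> is_square m"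
  shows "m ^ ((CARD('a) - 1) div 2) = -1"
proof -
  define h where "h = (CARD('a) - 1) div 2"
  have h: "2 * h = CARD('a) - 1"
    using odd by (simp add: h_def)
  have "card {0, 1 :: 'a} \<le> CARD('a)" by (intro card_mono) auto
  then have "h > 0" using h odd by (cases h) auto
  define S where "S = (\<lambda>x :: 'a. x ^ 2) ` (UNIV - {0})"
  define R where "R = {x :: 'a. poly (monom 1 h - 1) x = 0}"
  have m0: "m \<noteq> 0" using m by auto
  have "(m ^ h) ^ 2 = 1"
    using power_card_minus_1_eq_1[OF m0] h by (metis mult.commute power_mult)
  then have "m ^ h = 1 \<or> m ^ h = -1" by (simp add: power2_eq_1_iff)
  moreover have "m ^ h \<noteq> 1"
  proof
    assume "m ^ h = 1"
    then have "insert m S \<subseteq> R"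
      using power_card_minus_1_eq_1 h
      by (auto simp: R_def S_def poly_monom simp flip: power_mult)
    then have "card (insert m S) \<le> card R"
      by (intro card_mono) auto
    also have "card R \<le> degree (monom 1 h - 1 :: 'a poly)"
      unfolding R_def
    proof (rule card_poly_roots_bound)
      show "monom 1 h - 1 \<noteq> (0 :: 'a poly)"
        using \<open>h > 0\<close> by (metis degree_1 degree_monom_eq eq_iff_diff_eq_0 less_irrefl one_neq_zero)
    qed
    also have "\<dots> \<le> h"
      by (rule degree_diff_le) (auto simp: degree_monom_le)
    finally have "card (insert m S) \<le> h" .
    moreover have "m \<notin> S" using m by (auto simp: S_def)
    ultimately have "card S < h" by (simp add: S_def)
    moreover have "card (UNIV - {0 :: 'a}) \<le> 2 * card S"
      unfolding S_def
    proof (rule card_le_mult_card_image)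
      fix y :: 'a
      have "card {x \<in> UNIV - {0}. x ^ 2 = y} \<le> card {x. poly [:-y, 0, 1:] x = 0}"
        by (intro card_mono) (auto simp: power2_eq_square)
      also have "\<dots> \<le> 2"
        using card_poly_roots_bound[of "[:-y, 0, 1:]"] by simp
      finally show "card {x \<in> UNIV - {0}. x ^ 2 = y} \<le> 2" .
    qed auto
    ultimately show False using h by simp
  qed
  ultimately show ?thesis by (auto simp: h_def)
qed

text \<open>
  If there were no such pair, the group \<open>T\<close> of translations that preserve the squareness of
  \<open>w\<^sup>2 - k\<close> would contain all \<open>2 (a - 1/a)\<close>. Each value of \<open>a - 1/a\<close> is attained at most twice,
  which makes \<open>T\<close> too large to be a proper subgroup.
\<close>
lemma exists_translates_differing_in_squareness:
  fixes k :: "'a::{finite, field}"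
  assumes two: "(2::'a) \<noteq> 0" and k: "\<not> is_square k" and q: "CARD('a) > 3"
  obtains a w :: 'a where "a \<noteq> 0"
    "is_square ((w - (a - 1 / a)) ^ 2 - k) \<noteq> is_square ((w + (a - 1 / a)) ^ 2 - k)"
proof (rule ccontr)
  assume "\<not> thesis"
  with that have eq: "is_square ((w - (a - 1 / a)) ^ 2 - k) = is_square ((w + (a - 1 / a)) ^ 2 - k)"
    if "a \<noteq> 0" for a w using \<open>a \<noteq> 0\<close> by blast
  define H where "H w = is_square (w ^ 2 - k)" for w
  define T where "T = {t. \<forall>w. H (w + t) = H w}"
  define U where "U = (\<lambda>a :: 'a. 2 * (a - 1 / a)) ` (UNIV - {0})"
  have minus: "s - t \<in> T" if "s \<in> T" "t \<in> T" for s t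
  proof -
    have "H (w + (s - t)) = H w" for w
    proof -
      have "H (w + (s - t)) = H (w + (s - t) + t)" using that(2) unfolding T_def by blast
      also have "\<dots> = H (w + s)" by (simp add: algebra_simps)
      also have "\<dots> = H w" using that(1) by (simp add: T_def)
      finally show ?thesis .
    qed
    then show ?thesis by (simp add: T_def)
  qed
  have zero: "0 \<in> T" by (simp add: T_def)
  have add: "s + t \<in> T" if "s \<in> T" "t \<in> T" for s t
    using minus[OF that(1) minus[OF zero that(2)]] by simp
  have "U \<subseteq> T"
  proof
    fix t assume "t \<in> U"
    then obtain a where a: "a \<noteq> 0" "t = 2 * (a - 1 / a)" by (auto simp: U_def)
    have "H (w + t) = H w" for w
    proof -
      have "w + t = w + (a - 1 / a) + (a - 1 / a)" using a(2) by (simp only: mult_2 add.assoc)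
      moreover have "w = w + (a - 1 / a) - (a - 1 / a)" by simp
      ultimately show ?thesis
        using eq[OF a(1), of "w + (a - 1 / a)"] unfolding H_def by metis
    qed
    then show "t \<in> T" by (simp add: T_def)
  qed
  have "card (UNIV - {0 :: 'a}) \<le> 2 * card U"
    unfolding U_def
  proof (rule card_le_mult_card_image)
    fix y :: 'a
    have "{x \<in> UNIV - {0}. 2 * (x - 1 / x) = y} \<subseteq> {x. poly [:-2, -y, 2:] x = 0}"
      by (auto simp: field_simps)
    then have "card {x \<in> UNIV - {0}. 2 * (x - 1 / x) = y} \<le> card {x. poly [:-2, -y, 2:] x = 0}"
      by (intro card_mono) auto
    also have "\<dots> \<le> 2"
      using card_poly_roots_bound[of "[:-2, -y, 2:]"] two by simp
    finally show "card {x \<in> UNIV - {0}. 2 * (x - 1 / x) = y} \<le> 2" .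
  qed auto
  moreover have "card U \<le> card T" using \<open>U \<subseteq> T\<close> by (intro card_mono) auto
  ultimately have cardT: "CARD('a) - 1 \<le> 2 * card T" by simp
  \<comment> \<open>For \<open>c\<close> outside \<open>T\<close>, the cosets of \<open>0\<close>, \<open>c\<close> and \<open>-c\<close> are distinct, as \<open>T\<close> is closed under
    halving; so \<open>T\<close> would have at most \<open>q/3\<close> elements.\<close>
  have "T = UNIV"
  proof (rule ccontr)
    assume "T \<noteq> UNIV"
    then obtain c where c: "c \<notin> T" by blast
    have half: "2 * c \<notin> T"
    proof
      have "(*) 2 ` T = T"
      proof (rule card_subset_eq)
        show "(*) 2 ` T \<subseteq> T" 
        proof (rule image_subsetI)
          show "2 * t \<in> T" if "t \<in> T" for t using add[OF that that] by (simp only: mult_2)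
        qed
        show "card ((*) 2 ` T) = card T" using two by (intro card_image) (auto simp: inj_on_def)
      qed auto
      moreover assume "2 * c \<in> T"
      ultimately have "2 * c \<in> (*) 2 ` T" by simp
      with two c show False by auto
    qed
    have "card (T \<union> (+) c ` T \<union> (+) (- c) ` T) = card T + card T + card T"
    proof (subst card_Un_disjoint)
      show "(T \<union> (+) c ` T) \<inter> (+) (- c) ` T = {}"
      proof -
        have False if "s \<in> T" "t \<in> T" "s = - c + t" for s t
          using minus[OF that(2,1)] c that(3) by simp
        moreover have False if "s \<in> T" "t \<in> T" "c + s = - c + t" for s t
        proof -
          have "t - s = 2 * c" using that(3) by (simp add: algebra_simps)
          with minus[OF that(2,1)] half show False by simp
        qed
        ultimately show ?thesis by blast
      qed
      have "T \<inter> (+) c ` T = {}"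
      proof -
        have False if "s \<in> T" "t \<in> T" "s = c + t" for s t
          using minus[OF that(1,2)] c that(3) by simp
        then show ?thesis by blast
      qed
      then show "card (T \<union> (+) c ` T) + card ((+) (- c) ` T) = card T + card T + card T"
        by (simp add: card_Un_disjoint card_image)
    qed auto
    moreover have "card (T \<union> (+) c ` T \<union> (+) (- c) ` T) \<le> CARD('a)"
      by (intro card_mono) auto
    ultimately show False using cardT q by simp
  qed
  have H: "H w" for w
  proof -
    \<comment> \<open>The point \<open>(1 + k)/2\<close> comes from the factorisation \<open>k = (w - z) (w + z)\<close> with
      \<open>w - z = k\<close> and \<open>w + z = 1\<close>.\<close>
    have "((1 + k) / 2) ^ 2 - k = ((1 - k) / 2) ^ 2"
      using two four_neq_0[OF two] by (simp add: field_simps power2_eq_square)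
    then have "H ((1 + k) / 2)" by (auto simp: H_def)
    moreover have "w - (1 + k) / 2 \<in> T" using \<open>T = UNIV\<close> by simp
    then have "H ((1 + k) / 2 + (w - (1 + k) / 2)) = H ((1 + k) / 2)"
      by (simp only: T_def mem_Collect_eq)
    ultimately show ?thesis by simp
  qed
  \<comment> \<open>Subtracting \<open>k\<close> would permute the finite set of squares, so \<open>0 + k\<close> would be a square.\<close>
  have "(\<lambda>x. x - k) ` {x. is_square x} = {x. is_square x}"
  proof (rule card_subset_eq)
    show "(\<lambda>x. x - k) ` {x. is_square x} \<subseteq> {x. is_square x}"
      using H by (auto simp: H_def elim!: is_nth_powerE)
  qed (auto intro!: card_image simp: inj_on_def)
  moreover have "0 \<in> {x :: 'a. is_square x}" by simp
  ultimately obtain x where "is_square x" "0 = x - k" by (metis (no_types, lifting) imageE mem_Collect_eq)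
  with k show False by simp
qed

section \<open>Two by two matrices of determinant one\<close>

definition mat2 :: "'a \<Rightarrow> 'a \<Rightarrow> 'a \<Rightarrow> 'a \<Rightarrow> 'a::zero ^ 2 ^ 2" where
  "mat2 a b c d = vector [vector [a, b], vector [c, d]]"

lemma mat2_nth [simp]:
  "mat2 a b c d $ 1 $ 1 = a" "mat2 a b c d $ 1 $ 2 = b"
  "mat2 a b c d $ 2 $ 1 = c" "mat2 a b c d $ 2 $ 2 = d"
  by (simp_all add: mat2_def)

lemma mat_nth_2 [simp]:
  "(mat c :: 'a::zero ^ 2 ^ 2) $ 1 $ 1 = c" "(mat c :: 'a::zero ^ 2 ^ 2) $ 1 $ 2 = 0"
  "(mat c :: 'a::zero ^ 2 ^ 2) $ 2 $ 1 = 0" "(mat c :: 'a::zero ^ 2 ^ 2) $ 2 $ 2 = c"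
  by (simp_all add: mat_def)

lemma matrix_mult_nth_2 [simp]:
  "((A :: 'a::semiring_1 ^ 2 ^ 2) ** B) $ i $ j = A $ i $ 1 * B $ 1 $ j + A $ i $ 2 * B $ 2 $ j"
  by (simp add: matrix_matrix_mult_def sum_2)

lemma matrix_eq_2:
  "A = (B :: 'a ^ 2 ^ 2) \<longleftrightarrow> A $ 1 $ 1 = B $ 1 $ 1 \<and> A $ 1 $ 2 = B $ 1 $ 2 \<and>
     A $ 2 $ 1 = B $ 2 $ 1 \<and> A $ 2 $ 2 = B $ 2 $ 2"
  by (auto simp: vec_eq_iff forall_2)

lemma trace_2: "trace (A :: 'a::semiring_1 ^ 2 ^ 2) = A $ 1 $ 1 + A $ 2 $ 2"
  by (simp add: trace_def sum_2)

lemma in_SL2_iff: "A \<in> carrier SL2 \<longleftrightarrow> A $ 1 $ 1 * A $ 2 $ 2 - A $ 1 $ 2 * A $ 2 $ 1 = 1"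
  by (simp add: SL2_def det_2)

lemma mult_SL2 [simp]: "A \<otimes>\<^bsub>SL2\<^esub> B = A ** B" and one_SL2 [simp]: "\<one>\<^bsub>SL2\<^esub> = mat 1"
  by (simp_all add: SL2_def)

lemma inv_SL2:
  assumes "A \<in> carrier SL2"
  shows "inv\<^bsub>SL2\<^esub> A = mat2 (A $ 2 $ 2) (- (A $ 1 $ 2)) (- (A $ 2 $ 1)) (A $ 1 $ 1)"
proof (rule group.inv_equality[OF group_SL2])
  show "mat2 (A $ 2 $ 2) (- (A $ 1 $ 2)) (- (A $ 2 $ 1)) (A $ 1 $ 1) \<otimes>\<^bsub>SL2\<^esub> A = \<one>\<^bsub>SL2\<^esub>"
    using assms by (simp add: matrix_eq_2 in_SL2_iff algebra_simps)
  show "mat2 (A $ 2 $ 2) (- (A $ 1 $ 2)) (- (A $ 2 $ 1)) (A $ 1 $ 1) \<in> carrier SL2"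
    using assms by (simp add: in_SL2_iff algebra_simps)
qed (fact assms)

lemma scalar_in_center_SL2:
  assumes "A \<in> carrier SL2" "A \<in> range mat"
  shows "A \<in> group_center SL2"
  using assms by (auto simp: group_center_def matrix_eq_2 mult.commute)

text \<open>
  The Cayley-Hamilton theorem lets one compute powers of \<open>A\<close> in the polynomial ring: the remainder
  of \<open>x\<^sup>k\<close> modulo the characteristic polynomial satisfies the same recursion as the
  coordinates of \<open>A\<^sup>k\<close> with respect to \<open>1\<close> and \<open>A\<close>.
\<close>
lemma SL2_power_eq_1_if_char_poly_dvd:
  fixes A :: "'a::field ^ 2 ^ 2"
  assumes A: "A \<in> carrier SL2" and dvd: "[:1, - trace A, 1:] dvd monom 1 n - 1"
  shows "A [^]\<^bsub>SL2\<^esub> n = mat 1"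
proof -
  have reduce: "\<exists>b c. (\<forall>i j. (A [^]\<^bsub>SL2\<^esub> k) $ i $ j = mat b $ i $ j + c * A $ i $ j) \<and>
      [:1, - trace A, 1:] dvd monom 1 k - [:b, c:]" for k :: nat
  proof (induction k)
    case 0
    show ?case by (intro exI[of _ 1] exI[of _ 0]) (simp add: monom_0 flip: one_pCons)
  next
    case (Suc k)
    then obtain b c where bc: "\<And>i j. (A [^]\<^bsub>SL2\<^esub> k) $ i $ j = mat b $ i $ j + c * A $ i $ j"
      and d: "[:1, - trace A, 1:] dvd monom 1 k - [:b, c:]" by blast
    have "(A [^]\<^bsub>SL2\<^esub> Suc k) $ i $ j = mat (- c) $ i $ j + (b + c * trace A) * A $ i $ j" for i j
    proof -
      have "A $ 1 $ 1 * A $ 2 $ 2 = 1 + A $ 1 $ 2 * A $ 2 $ 1" using A by (simp add: in_SL2_iff algebra_simps)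
      then show ?thesis
        using exhaust_2[of i] exhaust_2[of j]
        by (auto simp: bc trace_2 algebra_simps)
    qed
    moreover have "monom 1 (Suc k) - [:- c, b + c * trace A:] =
        [:0, 1:] * (monom 1 k - [:b, c:]) + [:c:] * [:1, - trace A, 1:]"
      by (simp add: monom_Suc algebra_simps)
    then have "[:1, - trace A, 1:] dvd monom 1 (Suc k) - [:- c, b + c * trace A:]"
      using d by (metis dvd_add dvd_mult dvd_triv_right)
    ultimately show ?case by blast
  qed
  obtain b c where bc: "\<And>i j. (A [^]\<^bsub>SL2\<^esub> n) $ i $ j = mat b $ i $ j + c * A $ i $ j"
    and d: "[:1, - trace A, 1:] dvd monom 1 n - [:b, c:]" using reduce[of n] by blast
  have "[:1, - trace A, 1:] dvd (monom 1 n - 1) - (monom 1 n - [:b, c:])"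
    using dvd d by (rule dvd_diff)
  also have "\<dots> = [:b - 1, c:]" by (simp add: one_pCons)
  finally have "[:b - 1, c:] = 0"
    using dvd_imp_degree_le[of "[:1, - trace A, 1:]" "[:b - 1, c:]"]
    by (cases "[:b - 1, c:] = 0") (auto simp: degree_pCons_eq_if split: if_splits)
  then have "b = 1" "c = 0" by auto
  with bc show ?thesis by (simp add: matrix_eq_2)
qed

text \<open>
  In characteristic other than two, \<open>1\<close> and \<open>-1\<close> are the only involutory matrices of determinant one, since
  for an involution the inverse, which is the adjugate, equals the matrix itself. This halves
  the orders of torus elements on passing to the projective group.
\<close>
lemma SL2_scalar_if_power_double_eq_1:
  fixes A :: "'a::field ^ 2 ^ 2" and n :: nat
  assumes two: "(2::'a) \<noteq> 0" and A: "A \<in> carrier SL2" and n: "A [^]\<^bsub>SL2\<^esub> (2 * n) = mat 1"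
  shows "A [^]\<^bsub>SL2\<^esub> n \<in> range mat"
proof -
  interpret group "SL2 :: ('a ^ 2 ^ 2) monoid" by (rule group_SL2)
  define B where "B = A [^]\<^bsub>SL2\<^esub> n"
  have B: "B \<in> carrier SL2" using A by (simp add: B_def)
  have "B \<otimes>\<^bsub>SL2\<^esub> B = \<one>\<^bsub>SL2\<^esub>"
    using n A by (simp add: B_def nat_pow_mult mult_2 del: mult_SL2)
  then have "inv\<^bsub>SL2\<^esub> B = B" using B by (simp add: inv_equality)
  then have "B $ 1 $ 1 = B $ 2 $ 2" "- (B $ 1 $ 2) = B $ 1 $ 2" "- (B $ 2 $ 1) = B $ 2 $ 1"
    using inv_SL2[OF B] by (metis mat2_nth)+
  moreover have "x = 0" if "- x = x" for x :: 'a
  proof -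
    have "2 * x = x - (- x)" by simp
    also have "\<dots> = 0" using that by simp
    finally show ?thesis using two by simp
  qed
  ultimately have "B $ 1 $ 1 = B $ 2 $ 2" "B $ 1 $ 2 = 0" "B $ 2 $ 1 = 0" by blast+
  then have "B = mat (B $ 1 $ 1)" by (simp add: matrix_eq_2)
  then show ?thesis by (auto simp: B_def)
qed

text \<open>
  The two distinct eigenvalues are roots of \<open>x\<^bsup>q - 1\<^esup> - 1\<close>, so the characteristic polynomial
  divides it.
\<close>
lemma SL2_split_power:
  fixes A :: "'a::{finite, field} ^ 2 ^ 2"
  assumes A: "A \<in> carrier SL2" and tr: "trace A = a + 1 / a" and a: "a \<noteq> 0" "a \<noteq> 1 / a"
  shows "A [^]\<^bsub>SL2\<^esub> (CARD('a) - 1) = mat 1"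
proof (rule SL2_power_eq_1_if_char_poly_dvd[OF A])
  have root: "[:- b, 1:] dvd monom 1 (CARD('a) - 1) - 1" if "b \<noteq> 0" for b :: 'a
    using power_card_minus_1_eq_1[OF that] by (simp add: dvd_iff_poly_eq_0 poly_monom)
  have "[:- a, 1:] * [:- (1 / a), 1:] dvd monom 1 (CARD('a) - 1) - 1"
  proof -
    obtain r where r: "monom 1 (CARD('a) - 1) - 1 = [:- a, 1:] * r"
      using root[OF a(1)] by (elim dvdE)
    have "poly (monom 1 (CARD('a) - 1) - 1) (1 / a) = 0"
      using power_card_minus_1_eq_1[of "1 / a"] a(1) by (simp add: poly_monom)
    then have "(1 / a - a) * poly r (1 / a) = 0" unfolding r by (simp add: algebra_simps)
    then have "poly r (1 / a) = 0" using a(2) by simp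
    then have "[:- (1 / a), 1:] dvd r" by (simp add: poly_eq_0_iff_dvd)
    then show ?thesis unfolding r by (rule mult_dvd_mono[OF dvd_refl])
  qed
  also have "[:- a, 1:] * [:- (1 / a), 1:] = [:1, - trace A, 1:]"
    using a(1) by (simp add: tr)
  finally show "[:1, - trace A, 1:] dvd monom 1 (CARD('a) - 1) - 1" .
qed

text \<open>
  The Frobenius map interchanges the two conjugate roots \<open>x\<close> and \<open>s - x = 1/x\<close> of the
  characteristic polynomial \<open>P = x\<^sup>2 - s x + 1\<close>. To see this without a quadratic extension, complete
  the square: modulo \<open>P\<close> the polynomial \<open>L = x - s/2\<close> squares to the non-square
  \<open>m = (s\<^sup>2 - 4)/4\<close>, so that \<open>L\<^sup>q\<close> is \<open>m\<^bsup>(q - 1)/2\<^esup> L = - L\<close>, while also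
  \<open>L\<^sup>q = x\<^sup>q - s/2\<close>. Hence \<open>x\<^sup>q\<close> is congruent to \<open>s - x\<close>, and \<open>x\<^bsup>q + 1\<^esup>\<close> to \<open>1\<close>.
\<close>
lemma SL2_nonsplit_power:
  fixes A :: "'a::{finite, field} ^ 2 ^ 2"
  assumes q: "primepow CARD('a)" and two: "(2::'a) \<noteq> 0"
    and A: "A \<in> carrier SL2" and tr: "\<not> is_square (trace A ^ 2 - 4)"
  shows "A [^]\<^bsub>SL2\<^esub> (CARD('a) + 1) = mat 1"
proof (rule SL2_power_eq_1_if_char_poly_dvd[OF A])
  define s where "s = trace A"
  define P where "P = [:1, - s, 1:]"
  define m where "m = (s ^ 2 - 4) / 2 ^ 2"
  define h where "h = (CARD('a) - 1) div 2"
  define L where "L = [:- (s / 2), 1:]"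
  have odd: "odd CARD('a)" using q two by (rule odd_card)
  have h: "CARD('a) = Suc (2 * h)" using odd by (auto simp: h_def elim: oddE)
  have "\<not> is_square m"
  proof
    assume "is_square m"
    then obtain y where "m = y ^ 2" by (auto elim: is_nth_powerE)
    then have "s ^ 2 - 4 = y ^ 2 * 2 ^ 2"
      using two unfolding m_def by (metis nonzero_divide_eq_eq power_not_zero)
    then have "trace A ^ 2 - 4 = (y * 2) ^ 2" by (simp only: power_mult_distrib s_def)
    with tr show False using is_nth_powerI by blast
  qed
  with odd have mh: "m ^ h = -1" unfolding h_def by (rule euler_criterion_nonsquare)
  have L2: "L ^ 2 - [:m:] = P"
    using two four_neq_0[OF two] by (simp add: L_def P_def m_def power2_eq_square field_simps)
  have "P dvd (L ^ 2) ^ h - [:m:] ^ h"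
    unfolding L2[symmetric] by (subst power_diff_sumr2) simp
  also have "[:m:] ^ h = - 1"
    by (simp add: poly_const_pow mh one_pCons)
  finally have "P dvd L * ((L ^ 2) ^ h - - 1)" by (rule dvd_mult)
  also have "L * ((L ^ 2) ^ h - - 1) = L ^ CARD('a) + L"
    unfolding h by (simp only: power_mult power_Suc diff_minus_eq_add distrib_left mult_1_right)
  also have "L ^ CARD('a) = monom 1 CARD('a) - [:s / 2:]"
  proof -
    obtain n where n: "CARD('a) = CHAR('a) ^ n" using q by (rule card_power_CHAR)
    have "prime CHAR('a poly)"
      using prime_CHAR_semidom[where 'a = 'a] finite_imp_CHAR_pos[where 'a = 'a] by simp
    moreover have "CARD('a) = CHAR('a poly) ^ n" using n by simp
    ultimately have "(monom 1 1 + [:- (s / 2):]) ^ CARD('a) = monom 1 1 ^ CARD('a) + [:- (s / 2):] ^ CARD('a)"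
      by (rule freshmans_dream')
    also have "[:- (s / 2):] ^ CARD('a) = [:- (s / 2):]"
      by (simp add: poly_const_pow power_card_eq_same)
    also have "monom 1 1 + [:- (s / 2):] = L" by (simp add: L_def monom_Suc monom_0)
    finally show ?thesis by (simp add: monom_power)
  qed
  also have "monom 1 CARD('a) - [:s / 2:] + L = monom 1 CARD('a) - [:s, - 1:]"
    using two by (simp add: L_def)
  finally have "P dvd [:0, 1:] * (monom 1 CARD('a) - [:s, - 1:]) - P"
    by (rule dvd_diff[OF dvd_mult dvd_refl])
  also have "\<dots> = monom 1 (CARD('a) + 1) - 1"
    by (simp add: P_def monom_Suc one_pCons algebra_simps)
  finally show "[:1, - trace A, 1:] dvd monom 1 (CARD('a) + 1) - 1"
    by (simp add: P_def s_def)
qed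

text \<open>
  A non-scalar matrix has a cyclic vector \<open>v\<close>, and one of \<open>(1, 0)\<close>, \<open>(0, 1)\<close>, \<open>(1, 1)\<close> will do. The
  columns of the transition matrix are \<open>v\<close> and \<open>A v\<close>.
\<close>
lemma SL2_similar_to_companion:
  fixes A :: "'a::field ^ 2 ^ 2"
  assumes A: "A \<in> carrier SL2" "A \<notin> range mat"
  obtains P where "invertible P" "A ** P = P ** mat2 0 (- 1) 1 (trace A)"
proof -
  have d: "A $ 1 $ 1 * A $ 2 $ 2 = 1 + A $ 1 $ 2 * A $ 2 $ 1"
    using A by (simp add: in_SL2_iff algebra_simps)
  define P where "P x y = mat2 x (A $ 1 $ 1 * x + A $ 1 $ 2 * y) y (A $ 2 $ 1 * x + A $ 2 $ 2 * y)" for x y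
  have "A ** P x y = P x y ** mat2 0 (- 1) 1 (trace A)" for x y
    using d by (simp add: P_def matrix_eq_2 trace_2 algebra_simps)
  moreover have "\<exists>x y. det (P x y) \<noteq> 0"
  proof (rule ccontr)
    assume "\<not> ?thesis"
    then have "det (P x y) = 0" for x y by blast
    from this[of 1 0] this[of 0 1] this[of 1 1]
    have "A = mat (A $ 1 $ 1)" by (simp add: P_def det_2 matrix_eq_2)
    with A(2) show False by blast
  qed
  ultimately show thesis using that by (auto simp: invertible_det_nz)
qed

lemma SL2_similar_if_trace_eq:
  fixes A B :: "'a::field ^ 2 ^ 2"
  assumes A: "A \<in> carrier SL2" "A \<notin> range mat" and B: "B \<in> carrier SL2" "B \<notin> range mat"
    and tr: "trace A = trace B"
  obtains P Q where "P ** Q = mat 1" "Q ** P = mat 1" "A = P ** B ** Q"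
proof -
  define C where "C = mat2 0 (- 1) 1 (trace A)"
  obtain R S where "invertible R" "invertible S" and AR: "A ** R = R ** C" and BS: "B ** S = S ** C"
    using SL2_similar_to_companion[OF A] SL2_similar_to_companion[OF B] tr unfolding C_def by metis
  then obtain R' S' where R: "R ** R' = mat 1" "R' ** R = mat 1" and S: "S ** S' = mat 1" "S' ** S = mat 1"
    by (auto simp: invertible_def)
  have "(R ** S') ** (S ** R') = R ** (S' ** S) ** R'" by (simp only: matrix_mul_assoc)
  then have 1: "(R ** S') ** (S ** R') = mat 1" by (simp only: R S matrix_mul_rid)
  have "(S ** R') ** (R ** S') = S ** (R' ** R) ** S'" by (simp only: matrix_mul_assoc)
  then have 2: "(S ** R') ** (R ** S') = mat 1" by (simp only: R S matrix_mul_rid)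
  have "(R ** S') ** B ** (S ** R') = R ** S' ** (B ** S) ** R'" by (simp only: matrix_mul_assoc)
  also have "\<dots> = R ** (S' ** S) ** C ** R'" by (simp only: BS matrix_mul_assoc)
  also have "\<dots> = A ** (R ** R')" by (simp only: S matrix_mul_rid AR[symmetric] matrix_mul_assoc)
  finally have "A = (R ** S') ** B ** (S ** R')" by (simp only: R matrix_mul_rid)
  with 1 2 show thesis by (rule that)
qed

lemma similarity_hom_SL2:
  fixes P Q :: "'a::field ^ 2 ^ 2"
  assumes PQ: "P ** Q = mat 1" and QP: "Q ** P = mat 1"
  shows "group_hom SL2 SL2 (\<lambda>A. P ** A ** Q)"
proof -
  have "P ** (A ** B) ** Q = P ** A ** Q ** (P ** B ** Q)" for A B
  proof -
    have "P ** A ** Q ** (P ** B ** Q) = P ** A ** (Q ** P) ** B ** Q"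
      by (simp only: matrix_mul_assoc)
    then show ?thesis by (simp only: QP matrix_mul_rid matrix_mul_assoc)
  qed
  moreover have "det (P ** A ** Q) = det A" for A
  proof -
    have "det P * det Q = 1"
      using PQ by (metis det_I det_mul)
    then show ?thesis by (simp add: det_mul)
  qed
  ultimately have "(\<lambda>A. P ** A ** Q) \<in> hom SL2 SL2"
    by (auto simp: hom_def SL2_def)
  then show ?thesis
    by (simp add: group_hom_def group_hom_axioms_def group_SL2)
qed

section \<open>Commutators in the projective group\<close>

lemma (in group_hom) hom_commutator:
  assumes "x \<in> carrier G" "y \<in> carrier G"
  shows "h (commutator G x y) = commutator H (h x) (h y)"
  using assms by (simp add: commutator_def)

lemma coset_hom_PSL2:
  "group_hom SL2 PSL2 (\<lambda>A :: 'a::field ^ 2 ^ 2. group_center SL2 #>\<^bsub>SL2\<^esub> A)"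
proof -
  have "normal (group_center SL2) (SL2 :: ('a ^ 2 ^ 2) monoid)"
    by (intro group.group_center_normal group_SL2)
  then show ?thesis
    unfolding group_hom_def group_hom_axioms_def PSL2_def
    using group_PSL2[where 'a = 'a, unfolded PSL2_def] normal.r_coset_hom_Mod group_SL2 by blast
qed

lemma PSL2_ord_dvd_if_power_scalar:
  fixes A :: "'a::field ^ 2 ^ 2" and n :: nat
  assumes A: "A \<in> carrier SL2" and n: "A [^]\<^bsub>SL2\<^esub> n \<in> range mat"
  shows "group.ord PSL2 (group_center SL2 #>\<^bsub>SL2\<^esub> A) dvd n"
proof -
  interpret coset: group_hom SL2 PSL2 "\<lambda>A :: 'a ^ 2 ^ 2. group_center SL2 #>\<^bsub>SL2\<^esub> A"
    by (rule coset_hom_PSL2)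
  have "A [^]\<^bsub>SL2\<^esub> n \<in> group_center SL2"
    using A n coset.G.nat_pow_closed by (intro scalar_in_center_SL2) auto
  then have "group_center SL2 #>\<^bsub>SL2\<^esub> A [^]\<^bsub>SL2\<^esub> n = group_center SL2"
    using coset.G.group_center_normal coset.G.coset_join2 normal_imp_subgroup A
      coset.G.nat_pow_closed by metis
  then have "(group_center SL2 #>\<^bsub>SL2\<^esub> A) [^]\<^bsub>PSL2\<^esub> n = \<one>\<^bsub>PSL2\<^esub>"
    using coset.hom_nat_pow[OF A] by (simp add: PSL2_def)
  then show ?thesis
    using coset.H.pow_eq_id coset.hom_closed[OF A] by blast
qed

text \<open>
  \<open>A\<close> is similar to the commutator of \<open>X\<close> and \<open>Y\<close> because the traces agree. Conjugating \<open>X\<close> and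
  \<open>Y\<close> by the transition matrix turns their commutator into \<open>A\<close> and keeps the powers in question scalar.
\<close>
lemma coprime_commutator_PSL2_if_similar:
  fixes A X Y :: "'a::field ^ 2 ^ 2" and m n :: nat
  assumes A: "A \<in> carrier SL2" "A \<notin> range mat"
    and X: "X \<in> carrier SL2" "X [^]\<^bsub>SL2\<^esub> m \<in> range mat"
    and Y: "Y \<in> carrier SL2" "Y [^]\<^bsub>SL2\<^esub> n \<in> range mat"
    and mn: "coprime m n"
    and nonscalar: "commutator SL2 X Y \<notin> range mat"
    and tr: "trace (commutator SL2 X Y) = trace A"
  shows "coprime_commutator PSL2 (group_center SL2 #>\<^bsub>SL2\<^esub> A)"
proof -
  interpret coset: group_hom SL2 PSL2 "\<lambda>A :: 'a ^ 2 ^ 2. group_center SL2 #>\<^bsub>SL2\<^esub> A"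
    by (rule coset_hom_PSL2)
  have "commutator SL2 X Y \<in> carrier SL2"
    using X Y coset.G.m_closed coset.G.inv_closed unfolding commutator_def by blast
  then obtain P Q where PQ: "P ** Q = mat 1" "Q ** P = mat 1" and AP: "A = P ** commutator SL2 X Y ** Q"
    using SL2_similar_if_trace_eq[OF A _ nonscalar] tr by metis
  define \<phi> where "\<phi> B = P ** B ** Q" for B
  interpret \<phi>: group_hom SL2 SL2 \<phi>
    unfolding \<phi>_def using PQ by (rule similarity_hom_SL2)
  have scalar: "\<phi> B \<in> range mat" if "B \<in> range mat" for B
  proof -
    obtain c where c: "B = mat c" using \<open>B \<in> range mat\<close> by blast
    have "P ** mat c = mat c ** P" by (simp add: matrix_eq_2 mult.commute)
    then have "\<phi> B = mat c ** (P ** Q)" by (simp add: \<phi>_def c matrix_mul_assoc)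
    then show ?thesis by (simp add: PQ)
  qed
  have "A = commutator SL2 (\<phi> X) (\<phi> Y)"
    using AP \<phi>.hom_commutator[OF X(1) Y(1)] by (simp add: \<phi>_def)
  then have "group_center SL2 #>\<^bsub>SL2\<^esub> A =
      commutator PSL2 (group_center SL2 #>\<^bsub>SL2\<^esub> \<phi> X) (group_center SL2 #>\<^bsub>SL2\<^esub> \<phi> Y)"
    using coset.hom_commutator[OF \<phi>.hom_closed[OF X(1)] \<phi>.hom_closed[OF Y(1)]] by simp
  moreover have "group.ord PSL2 (group_center SL2 #>\<^bsub>SL2\<^esub> \<phi> X) dvd m"
    using \<phi>.hom_nat_pow[OF X(1)] scalar[OF X(2)]
    by (intro PSL2_ord_dvd_if_power_scalar \<phi>.hom_closed X) simp
  moreover have "group.ord PSL2 (group_center SL2 #>\<^bsub>SL2\<^esub> \<phi> Y) dvd n"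
    using \<phi>.hom_nat_pow[OF Y(1)] scalar[OF Y(2)]
    by (intro PSL2_ord_dvd_if_power_scalar \<phi>.hom_closed Y) simp
  ultimately show ?thesis
    unfolding coprime_commutator_def
    using coset.hom_closed[OF \<phi>.hom_closed[OF X(1)]] coset.hom_closed[OF \<phi>.hom_closed[OF Y(1)]]
      coprime_divisors[OF _ _ mn] by blast
qed

text \<open>
  Rules out a scalar commutator by comparing entries of \<open>X Y\<close> and \<open>Y X\<close>, without inverses.
\<close>
lemma SL2_mult_eq_scalar_mult_if_commutator_scalar:
  fixes X Y :: "'a::field ^ 2 ^ 2"
  assumes "X \<in> carrier SL2" "Y \<in> carrier SL2" "commutator SL2 X Y = mat c"
  shows "X ** Y = Y ** X ** mat c"
proof -
  interpret group "SL2 :: ('a ^ 2 ^ 2) monoid" by (rule group_SL2)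
  have "inv\<^bsub>SL2\<^esub> (Y \<otimes>\<^bsub>SL2\<^esub> X) \<otimes>\<^bsub>SL2\<^esub> (X \<otimes>\<^bsub>SL2\<^esub> Y) = commutator SL2 X Y"
    using assms(1,2) by (simp add: commutator_def inv_mult_group m_assoc del: mult_SL2)
  then have "X \<otimes>\<^bsub>SL2\<^esub> Y = Y \<otimes>\<^bsub>SL2\<^esub> X \<otimes>\<^bsub>SL2\<^esub> commutator SL2 X Y"
    using assms(1,2) inv_solve_left'[of "commutator SL2 X Y" "Y \<otimes>\<^bsub>SL2\<^esub> X" "X \<otimes>\<^bsub>SL2\<^esub> Y"]
      m_closed inv_closed unfolding commutator_def by blast
  with assms(3) show ?thesis by simp
qed

lemma trace_commutator_SL2:
  assumes "X \<in> carrier SL2" "Y \<in> carrier SL2"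
  shows "trace (commutator SL2 X Y) = trace (mat2 (X $ 2 $ 2) (- (X $ 1 $ 2)) (- (X $ 2 $ 1)) (X $ 1 $ 1) **
    mat2 (Y $ 2 $ 2) (- (Y $ 1 $ 2)) (- (Y $ 2 $ 1)) (Y $ 1 $ 1) ** X ** Y)"
  using assms by (simp only: commutator_def inv_SL2 mult_SL2)

lemma exists_not_self_inverse:
  assumes "CARD('a::{finite, field}) > 3"
  obtains a :: "'a::{finite, field}" where "a \<noteq> 0" "a \<noteq> 1 / a"
proof -
  have "card {0, 1, - 1 :: 'a} \<le> 3" by (simp add: card_insert_if)
  with assms have "{0, 1, - 1 :: 'a} \<noteq> UNIV" by force
  then obtain a :: 'a where a: "a \<noteq> 0" "a \<noteq> 1" "a \<noteq> - 1" by blast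
  then have "a ^ 2 \<noteq> 1" by (simp add: power2_eq_1_iff)
  with a(1) have "a \<noteq> 1 / a" by (simp add: field_simps power2_eq_square)
  with a(1) show thesis by (rule that)
qed

text \<open>
  A unipotent \<open>X\<close> and a split \<open>Y\<close> suffice; this includes \<open>c = 0\<close>, where the commutator is
  unipotent, and all of characteristic two.
\<close>
lemma coprime_commutator_PSL2_if_trace_minus_2_square:
  fixes A :: "'a::{finite, field} ^ 2 ^ 2"
  assumes q: "CARD('a) > 3" and A: "A \<in> carrier SL2" "A \<notin> range mat"
    and tr: "is_square (trace A - 2)"
  shows "coprime_commutator PSL2 (group_center SL2 #>\<^bsub>SL2\<^esub> A)"
proof -
  obtain a :: 'a where a: "a \<noteq> 0" "a \<noteq> 1 / a" using q by (rule exists_not_self_inverse)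
  obtain c where c: "trace A - 2 = c ^ 2" using tr by (auto elim: is_nth_powerE)
  define X Y where "X = mat2 1 1 0 (1 :: 'a)" and "Y = mat2 a 0 c (1 / a)"
  have X: "X \<in> carrier SL2" and Y: "Y \<in> carrier SL2"
    using a(1) by (simp_all add: in_SL2_iff X_def Y_def)
  have "X [^]\<^bsub>SL2\<^esub> n = mat2 1 (of_nat n) 0 1" for n :: nat
    by (induction n) (simp_all add: X_def matrix_eq_2)
  moreover have "of_nat CARD('a) = (0 :: 'a)"
    using CHAR_dvd_CARD[where 'a = 'a] by (simp add: of_nat_eq_0_iff_char_dvd)
  ultimately have "X [^]\<^bsub>SL2\<^esub> CARD('a) = mat 1"
    by (simp add: matrix_eq_2)
  then have "X [^]\<^bsub>SL2\<^esub> CARD('a) \<in> range mat" by simp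
  moreover have "Y [^]\<^bsub>SL2\<^esub> (CARD('a) - 1) = mat 1"
    using Y _ a by (rule SL2_split_power) (simp add: Y_def trace_2)
  then have "Y [^]\<^bsub>SL2\<^esub> (CARD('a) - 1) \<in> range mat" by simp
  moreover have "coprime CARD('a) (CARD('a) - 1)"
    using q by (intro coprime_diff_one_right_nat) simp
  moreover have "commutator SL2 X Y \<notin> range mat"
  proof
    assume "commutator SL2 X Y \<in> range mat"
    then obtain d where "X ** Y = Y ** X ** mat d"
      using SL2_mult_eq_scalar_mult_if_commutator_scalar[OF X Y] by blast
    then have "a + c = a * d" "1 / a = a * d" "c = c * d"
      by (simp_all add: matrix_eq_2 X_def Y_def)
    show False
    proof (cases "c = 0")
      case True
      then have "d = 1" using \<open>a + c = a * d\<close> a(1) by simp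
      then show False using \<open>1 / a = a * d\<close> a(2) by simp
    next
      case False
      then have "d = 1" using \<open>c = c * d\<close> by simp
      then show False using \<open>a + c = a * d\<close> False by simp
    qed
  qed
  moreover have "trace (commutator SL2 X Y) = trace A"
  proof -
    have "trace (commutator SL2 X Y) = 2 + c ^ 2"
      using a(1) unfolding trace_commutator_SL2[OF X Y]
      by (simp add: X_def Y_def trace_2 power2_eq_square algebra_simps flip: add_divide_distrib)
    with c show ?thesis by (simp add: algebra_simps)
  qed
  ultimately show ?thesis
    using A X Y by (intro coprime_commutator_PSL2_if_similar)
qed

text \<open>
  \<open>X\<close> is taken in a split torus and \<open>Y\<close> in a non-split one.
\<close>
lemma coprime_commutator_PSL2_if_trace_minus_2_nonsquare:
  fixes A :: "'a::{finite, field} ^ 2 ^ 2"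
  assumes pp: "primepow CARD('a)" and q: "CARD('a) > 3" and A: "A \<in> carrier SL2" "A \<notin> range mat"
    and tr: "\<not> is_square (trace A - 2)"
  shows "coprime_commutator PSL2 (group_center SL2 #>\<^bsub>SL2\<^esub> A)"
proof -
  define k where "k = trace A - 2"
  have two: "(2::'a) \<noteq> 0" using tr is_square_if_two_eq_0 by blast
  define h where "h = (CARD('a) - 1) div 2"
  have h: "CARD('a) = Suc (2 * h)" using odd_card[OF pp two] by (auto simp: h_def elim: oddE)
  obtain a w :: 'a where a: "a \<noteq> 0"
    and aw: "is_square ((w - (a - 1 / a)) ^ 2 - k) \<noteq> is_square ((w + (a - 1 / a)) ^ 2 - k)"
    using exists_translates_differing_in_squareness[OF two tr q] unfolding k_def by blast
  define u where "u = a - 1 / a"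
  have u: "u \<noteq> 0" using aw by (auto simp: u_def)
  have w: "w \<noteq> 0" using aw by (auto simp: power2_commute)
  \<comment> \<open>The trace of the commutator is \<open>2 + (1 - e) u\<^sup>2\<close>, where \<open>e\<close> is the product of the diagonal
    entries of \<open>Y\<close>; this choice of \<open>e\<close> makes it \<open>2 + k\<close>.\<close>
  define e where "e = 1 - k / u ^ 2"
  define X Y where "X = mat2 a 0 0 (1 / a)" and "Y = mat2 (w / u) 1 (e - 1) (e * u / w)"
  have X: "X \<in> carrier SL2" and Y: "Y \<in> carrier SL2"
    using a u w by (simp_all add: in_SL2_iff X_def Y_def)
  have a': "a \<noteq> 1 / a" using u by (auto simp: u_def)
  have "X [^]\<^bsub>SL2\<^esub> (2 * h) = mat 1"
    using SL2_split_power[OF X _ a a'] h by (simp add: X_def trace_2)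
  then have "X [^]\<^bsub>SL2\<^esub> h \<in> range mat"
    by (rule SL2_scalar_if_power_double_eq_1[OF two X])
  moreover have "\<not> is_square (trace Y ^ 2 - 4)"
  proof
    define H where "H x = x ^ 2 - k" for x
    assume "is_square (trace Y ^ 2 - 4)"
    then obtain y where y: "trace Y ^ 2 - 4 = y ^ 2" by (auto elim: is_nth_powerE)
    have "trace Y * (u * w) = w ^ 2 + e * u ^ 2"
      using u w by (simp add: Y_def trace_2 power2_eq_square distrib_right)
    also have "w ^ 2 + e * u ^ 2 = w ^ 2 + u ^ 2 - k"
      using u by (simp add: e_def left_diff_distrib)
    finally have "(trace Y * (u * w)) ^ 2 = (w ^ 2 + u ^ 2 - k) ^ 2"
      by simp
    then have "(trace Y ^ 2 - 4) * (u * w) ^ 2 = (w ^ 2 + u ^ 2 - k) ^ 2 - 4 * (u * w) ^ 2"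
      by (simp only: power_mult_distrib left_diff_distrib)
    also have "\<dots> = H (w - u) * H (w + u)"
      by (simp add: H_def power2_eq_square algebra_simps)
    finally have "y ^ 2 * (u * w) ^ 2 = H (w - u) * H (w + u)" by (simp only: y)
    then have prod: "H (w - u) * H (w + u) = (y * u * w) ^ 2"
      by (simp only: power_mult_distrib mult.assoc)
    \<comment> \<open>As \<open>H\<close> has no zeros, a square product forces both factors to be squares or neither.\<close>
    have nz: "H x \<noteq> 0" for x
      using tr by (auto simp: H_def k_def[symmetric])
    have "H (w + u) = (y * u * w / x) ^ 2" if "H (w - u) = x ^ 2" for x
      using prod nz[of "w - u"] that by (simp add: power_divide nonzero_eq_divide_eq mult.commute)
    moreover have "H (w - u) = (y * u * w / x) ^ 2" if "H (w + u) = x ^ 2" for x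
      using prod nz[of "w + u"] that by (simp add: power_divide nonzero_eq_divide_eq mult.commute)
    ultimately have "is_square (H (w - u)) = is_square (H (w + u))"
      by (metis is_nth_powerE is_nth_powerI)
    with aw show False by (simp add: H_def u_def)
  qed
  then have "Y [^]\<^bsub>SL2\<^esub> (2 * Suc h) = mat 1"
    using SL2_nonsplit_power[OF pp two Y] h by simp
  then have "Y [^]\<^bsub>SL2\<^esub> Suc h \<in> range mat"
    by (rule SL2_scalar_if_power_double_eq_1[OF two Y])
  moreover have "coprime h (Suc h)" by simp
  moreover have "commutator SL2 X Y \<notin> range mat"
  proof
    assume "commutator SL2 X Y \<in> range mat"
    then obtain d where "X ** Y = Y ** X ** mat d"
      using SL2_mult_eq_scalar_mult_if_commutator_scalar[OF X Y] by blast
    then have "a * (w / u) = w / u * a * d" "a = 1 / a * d"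
      by (simp_all add: matrix_eq_2 X_def Y_def)
    with a a' u w show False by auto
  qed
  moreover have "trace (commutator SL2 X Y) = trace A"
  proof -
    have "trace (commutator SL2 X Y) = 2 * e - (e - 1) * (a ^ 2 + 1 / a ^ 2)"
      using a u w unfolding trace_commutator_SL2[OF X Y]
      by (simp add: X_def Y_def trace_2 power2_eq_square algebra_simps)
    also have "\<dots> = 2 + (1 - e) * u ^ 2"
      using a by (simp add: u_def power2_eq_square field_simps)
    also have "\<dots> = 2 + k" using u by (simp add: e_def)
    finally show ?thesis by (simp add: k_def)
  qed
  ultimately show ?thesis
    using A X Y by (intro coprime_commutator_PSL2_if_similar)
qed

lemma coprime_commutator_PSL2_scalar:
  fixes A :: "'a::field ^ 2 ^ 2"
  assumes A: "A \<in> carrier SL2" "A \<in> range mat"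
  shows "coprime_commutator PSL2 (group_center SL2 #>\<^bsub>SL2\<^esub> A)"
proof -
  interpret G: group "PSL2 :: ('a ^ 2 ^ 2) set monoid" by (rule group_PSL2)
  have "group_center SL2 #>\<^bsub>SL2\<^esub> A = \<one>\<^bsub>PSL2\<^esub>"
    using scalar_in_center_SL2[OF A] A(1) group.coset_join2[OF group_SL2]
      normal_imp_subgroup[OF group.group_center_normal[OF group_SL2]]
    by (metis (no_types, lifting) PSL2_def one_FactGroup)
  also have "\<dots> = commutator PSL2 \<one>\<^bsub>PSL2\<^esub> \<one>\<^bsub>PSL2\<^esub>" by (simp add: commutator_def)
  finally show ?thesis
    unfolding coprime_commutator_def using G.one_closed by (metis G.ord_id coprime_1_left)
qed

theorem theorem1p1:
  fixes q :: nat
    and g :: "('a::{finite, field} ^ 2 ^ 2) set"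
  assumes "primepow q" and "q > 3"
    and "CARD('a) = q"
    and "g \<in> carrier (PSL2 :: ('a ^ 2 ^ 2) set monoid)"
  shows "coprime_commutator (PSL2 :: ('a ^ 2 ^ 2) set monoid) g"
proof -
  obtain A :: "'a ^ 2 ^ 2" where A: "A \<in> carrier SL2" and g: "g = group_center SL2 #>\<^bsub>SL2\<^esub> A"
    using assms(4) by (auto simp: PSL2_def FactGroup_def RCOSETS_def)
  show ?thesis
  proof (cases "A \<in> range mat")
    case True
    with A show ?thesis unfolding g by (rule coprime_commutator_PSL2_scalar)
  next
    case False
    with A assms(1-3) show ?thesis
      unfolding g
      by (cases "is_square (trace A - 2)")
        (auto intro: coprime_commutator_PSL2_if_trace_minus_2_square coprime_commutator_PSL2_if_trace_minus_2_nonsquare)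
  qed
qed

end
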